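(* Suppose $\mathcal{F}$ is a collection of unary operations on a nonempty set $A$. Let $S=\{a\in A\mid f(a)=a\text{ for all }f\in\mathcal{F}\}$. Then the following are equivalent. (1) $(A,\mathcal{F})$ is a Ramsey algebra. (2) Every element of $A$ can be sent to an element of $S$ by finitely many applications of the unary operations in $\mathcal{F}$.
   Context: $\omega=\{0,1,2,\dotsc\}$ and $\mathbb{N}$ is the set of positive integers. An algebra is a pair $(A,\mathcal{F})$ where $A$ is a nonempty set and $\mathcal{F}$ is a (possibly empty) collection of finitary operations on $A$, none of which is nullary. For a finite sequence $\vec{x}$ whose length is the arity of $f$, $f(\vec{x})$ denotes $f$ applied to the terms of $\vec{x}$ in order; whenever $f(\vec{x})$ is written, the length of $\vec{x}$ is assumed to equal the arity of $f$. The symbol $\ast$ denotes concatenation of sequences. Orderly terms: an operation $f\colon A^m\to A$ is an orderly composition of a collection $\mathcal{C}$ of operations on $A$ if there are $n,k_1,\dotsc,k_n\in\mathbb{N}$ and $g,h_1,\dotsc,h_n\in\mathcal{C}$ such that $g$ is $n$-ary, $h_i$ is $k_i$-ary, $m=\sum_{i=1}^n k_i$, and $f(\vec{x}_1\ast\dotsb\ast\vec{x}_n)=g(h_1(\vec{x}_1),\dotsc,h_n(\vec{x}_n))$ for all finite sequences $\vec{x}_i$ in $A$ of length $k_i$. The collection of orderly terms over $\mathcal{F}$ is the smallest collection of operations on $A$ that includes $\mathcal{F}$, contains the identity function on $A$, and is closed under orderly composition. Reductions: for infinite sequences $\vec{a},\vec{b}\in{}^{\omega}A$ (sequences indexed by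 $\omega$), $\vec{b}\leq_{\mathcal{F}}\vec{a}$ ($\vec{b}$ is a reduction of $\vec{a}$) means that there are finite sequences $\vec{a}_k$ and orderly terms $f_k$ over $\mathcal{F}$ ($k\in\omega$) such that $\vec{a}_0\ast\vec{a}_1\ast\vec{a}_2\ast\dotsb$ is a subsequence of $\vec{a}$ and $\vec{b}(k)=f_k(\vec{a}_k)$ for all $k\in\omega$. $\mathrm{FR}_{\mathcal{F}}(\vec{b})$ is the set of all elements $f(\vec{b}_0)$ with $f$ an orderly term over $\mathcal{F}$ and $\vec{b}_0$ a finite subsequence of $\vec{b}$. $(A,\mathcal{F})$ is a Ramsey algebra if for every $\vec{a}\in{}^{\omega}A$ and $X\subseteq A$ there exists $\vec{b}\leq_{\mathcal{F}}\vec{a}$ such that $\mathrm{FR}_{\mathcal{F}}(\vec{b})$ is either contained in or disjoint from $X$. "Finitely many applications" includes zero applications; different operations of $\mathcal{F}$ may be applied successively. *)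

theory Defs
  imports Main "HOL-Library.FuncSet" "HOL-Library.NList"
begin

text \<open>A finitary operation is a pair of its arity and a function on argument lists.\<close>

type_synonym 'a oper = "nat \<times> ('a list \<Rightarrow> 'a)"

abbreviation arity :: "'a oper \<Rightarrow> nat" where
  "arity f \<equiv> fst f"

abbreviation app :: "'a oper \<Rightarrow> 'a list \<Rightarrow> 'a" where
  "app f \<equiv> snd f"

text \<open>
  The non-nullary operations on \<open>A\<close>. Functions are extensional (\<open>\<rightarrow>\<^sub>E\<close>), so that
  equality of representations is equality of operations \<open>A\<^sup>m \<rightarrow> A\<close>.
\<close>

definition operations :: "'a set \<Rightarrow> 'a oper set" where
  "operations A = {f. 0 < arity f \<and> app f \<in> nlists (arity f) A \<rightarrow>\<^sub>E A}"

definition algebra :: "'a set \<Rightarrow> 'a oper set \<Rightarrow> bool" where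
  "algebra A F \<longleftrightarrow> A \<noteq> {} \<and> F \<subseteq> operations A"

definition id_oper :: "'a set \<Rightarrow> 'a oper" where
  "id_oper A = (1, \<lambda>xs\<in>nlists 1 A. hd xs)"

text \<open>
  Here \<open>hs\<close> is the list of the \<open>h\<^sub>i\<close>, \<open>xss\<close> that of the argument tuples \<open>x\<^sub>i\<close>. The numbers
  \<open>n = arity g\<close> and \<open>k\<^sub>i = arity h\<^sub>i\<close> are positive when \<open>C \<subseteq> operations A\<close>.
\<close>

definition orderly_composition :: "'a set \<Rightarrow> 'a oper set \<Rightarrow> 'a oper \<Rightarrow> bool" where
  "orderly_composition A C f \<longleftrightarrow>
     f \<in> operations A \<and>
     (\<exists>g\<in>C. \<exists>hs. set hs \<subseteq> C \<and> length hs = arity g \<and>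
        arity f = (\<Sum>h\<leftarrow>hs. arity h) \<and>
        (\<forall>xss. list_all2 (\<lambda>h xs. xs \<in> nlists (arity h) A) hs xss \<longrightarrow>
           app f (concat xss) = app g (map2 app hs xss)))"

definition orderly_terms :: "'a set \<Rightarrow> 'a oper set \<Rightarrow> 'a oper set" where
  "orderly_terms A F =
     \<Inter> {C. C \<subseteq> operations A \<and> F \<subseteq> C \<and> id_oper A \<in> C \<and>
            (\<forall>f. orderly_composition A C f \<longrightarrow> f \<in> C)}"

text \<open>
  The infinite concatenation of a sequence of \<^emph>\<open>nonempty\<close> lists: the first \<open>n + 1\<close> lists
  already contain an entry at position \<open>n\<close>.
\<close>

definition inf_concat :: "(nat \<Rightarrow> 'a list) \<Rightarrow> nat \<Rightarrow> 'a" where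
  "inf_concat xss n = concat (map xss [0..<Suc n]) ! n"

definition subsequence_of :: "(nat \<Rightarrow> 'a) \<Rightarrow> (nat \<Rightarrow> 'a) \<Rightarrow> bool" where
  "subsequence_of c a \<longleftrightarrow> (\<exists>r. strict_mono r \<and> c = a \<circ> r)"

definition finite_subsequence_of :: "'a list \<Rightarrow> (nat \<Rightarrow> 'a) \<Rightarrow> bool" where
  "finite_subsequence_of xs a \<longleftrightarrow> (\<exists>ns. sorted_wrt (<) ns \<and> xs = map a ns)"

text \<open>
  \<open>reduction A F b a\<close> means \<open>b \<le>\<^bsub>F\<^esub> a\<close>. The lists \<open>as k\<close> are nonempty because orderly terms
  are not nullary; if \<open>a\<close> has its values in \<open>A\<close>, then so has \<open>b\<close>.
\<close>

definition reduction ::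
    "'a set \<Rightarrow> 'a oper set \<Rightarrow> (nat \<Rightarrow> 'a) \<Rightarrow> (nat \<Rightarrow> 'a) \<Rightarrow> bool" where
  "reduction A F b a \<longleftrightarrow>
     (\<exists>as f. subsequence_of (inf_concat as) a \<and>
        (\<forall>k. f k \<in> orderly_terms A F \<and> length (as k) = arity (f k) \<and>
             b k = app (f k) (as k)))"

definition FR :: "'a set \<Rightarrow> 'a oper set \<Rightarrow> (nat \<Rightarrow> 'a) \<Rightarrow> 'a set" where
  "FR A F b =
     {app f xs | f xs. f \<in> orderly_terms A F \<and> finite_subsequence_of xs b \<and>
                       length xs = arity f}"

definition ramsey_algebra :: "'a set \<Rightarrow> 'a oper set \<Rightarrow> bool" where
  "ramsey_algebra A F \<longleftrightarrow>
     algebra A F \<and>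
     (\<forall>a X. range a \<subseteq> A \<longrightarrow> X \<subseteq> A \<longrightarrow>
        (\<exists>b. reduction A F b a \<and> (FR A F b \<subseteq> X \<or> FR A F b \<inter> X = {})))"

end

theory Submission
  imports Defs "HOL-Library.Infinite_Set"
begin

text \<open>
  The orderly terms over unary operations are exactly the composites of finitely many of them. If all
  elements reach \<open>S\<close>, a sequence reduces to one in \<open>S\<close>, and the pigeonhole principle applies, as
  terms fix \<open>S\<close> pointwise. If \<open>x\<close> does not reach \<open>S\<close>, every element reachable from \<open>x\<close> is moved
  by some operation, which gives a function \<open>g\<close> without fixed points on the elements reachable
  from \<open>x\<close>. Some \<open>X\<close> splits every forward orbit of \<open>g\<close>, so no reduction of the constant sequence
  \<open>x\<close> is homogeneous for \<open>X\<close>.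
\<close>

section \<open>Splitting the orbits of a fixed-point-free function\<close>

text \<open>If the iterates of \<open>c\<close> are pairwise distinct, those with even exponent
  serve as \<open>T\<close>. Otherwise the orbit runs into a cycle, and one point of the cycle
  suffices: it recurs forever, and its successor differs from it. Both alternatives must occur
  beyond every \<open>n\<close>, since other orbits may share only a tail with that of
  \<open>c\<close>.\<close>

lemma tails_of_orbit_split:
  fixes g :: "'a \<Rightarrow> 'a"
  assumes moves: "\<And>n. g ((g ^^ n) c) \<noteq> (g ^^ n) c"
  shows "\<exists>T. \<forall>n. (\<exists>i\<ge>n. (g ^^ i) c \<in> T) \<and> (\<exists>i\<ge>n. (g ^^ i) c \<notin> T)"
proof (cases "inj (\<lambda>n. (g ^^ n) c)")
  case True
  let ?T = "{(g ^^ (2 * n)) c | n. True}"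
  have even_in: "(g ^^ (2 * n)) c \<in> ?T" for n by blast
  have odd_notin: "(g ^^ Suc (2 * n)) c \<notin> ?T" for n
  proof
    assume "(g ^^ Suc (2 * n)) c \<in> ?T"
    then obtain k where "(g ^^ Suc (2 * n)) c = (g ^^ (2 * k)) c" by blast
    then have "Suc (2 * n) = 2 * k" using injD[OF True] by blast
    then show False by presburger
  qed
  show ?thesis
  proof (intro exI[of _ ?T] allI conjI)
    show "\<exists>i\<ge>n. (g ^^ i) c \<in> ?T" for n
      by (rule exI[of _ "2 * n"], rule conjI[OF _ even_in]) simp
    show "\<exists>i\<ge>n. (g ^^ i) c \<notin> ?T" for n
      by (rule exI[of _ "Suc (2 * n)"], rule conjI[OF _ odd_notin]) simp
  qed
next
  case False
  then obtain i j where ij: "i < j" "(g ^^ i) c = (g ^^ j) c"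
    unfolding inj_def by (metis linorder_neqE_nat)
  \<comment> \<open>The repetition makes \<open>p\<close> a period of the orbit from index
    \<open>i\<close> on.\<close>
  define p where "p = j - i"
  have "(g ^^ p) ((g ^^ i) c) = (g ^^ (p + i)) c" by (simp add: funpow_add)
  then have p: "p > 0" "(g ^^ p) ((g ^^ i) c) = (g ^^ i) c"
    using ij by (simp_all add: p_def)
  have per: "(g ^^ (n * p + i)) c = (g ^^ i) c" for n
  proof (induction n)
    case (Suc n)
    have "(g ^^ (Suc n * p + i)) c = (g ^^ p) ((g ^^ (n * p + i)) c)"
      by (simp add: funpow_add add.assoc)
    then show ?case using Suc p by simp
  qed simp
  have le: "n \<le> n * p + i" for n
    using p(1) by (simp add: trans_le_add1)
  show ?thesis
  proof (intro exI[of _ "{(g ^^ i) c}"] allI conjI)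
    show "\<exists>k\<ge>n. (g ^^ k) c \<in> {(g ^^ i) c}" for n
      using le per by blast
    \<comment> \<open>The witness is one step after a return to the chosen point, which
      \<open>g\<close> moves.\<close>
    show "\<exists>k\<ge>n. (g ^^ k) c \<notin> {(g ^^ i) c}" for n
      using le[of n] per[of n] moves[of i] by (intro exI[of _ "Suc (n * p + i)"]) simp
  qed
qed

text \<open>Points whose forward orbits meet form classes. Choosing one representative per class and
  splitting the tails of its orbit splits every fixed-point-free orbit in that class.\<close>

lemma orbits_split:
  fixes g :: "'a \<Rightarrow> 'a"
  shows "\<exists>X. \<forall>y. (\<forall>n. g ((g ^^ n) y) \<noteq> (g ^^ n) y) \<longrightarrow>
    (\<exists>i. (g ^^ i) y \<in> X) \<and> (\<exists>i. (g ^^ i) y \<notin> X)"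
proof -
  \<comment> \<open>\<open>E y\<close> is the connected component of \<open>y\<close> in the graph
    of \<open>g\<close>. The choice of \<open>rep y\<close> depends only on the set
    \<open>E y\<close>, so \<open>rep\<close> is constant along orbits once
    \<open>E (g y) = E y\<close> is known.\<close>
  define E where "E y = {z. \<exists>m n. (g ^^ m) y = (g ^^ n) z}" for y
  define rep where "rep y = (SOME z. z \<in> E y)" for y
  have rep: "rep y \<in> E y" for y
    unfolding rep_def by (rule someI[of _ y]) (auto simp: E_def)
  have E_step: "E (g y) = E y" for y
  proof
    show "E (g y) \<subseteq> E y"
    proof
      fix z assume "z \<in> E (g y)"
      then obtain m n where "(g ^^ m) (g y) = (g ^^ n) z" unfolding E_def by blast
      then have "(g ^^ Suc m) y = (g ^^ n) z" by (simp add: funpow_swap1)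
      then show "z \<in> E y" unfolding E_def by blast
    qed
    show "E y \<subseteq> E (g y)"
    proof
      fix z assume "z \<in> E y"
      then obtain m n where "(g ^^ m) y = (g ^^ n) z" unfolding E_def by blast
      then have "(g ^^ m) (g y) = (g ^^ Suc n) z" by (simp add: funpow_swap1[symmetric])
      then show "z \<in> E (g y)" unfolding E_def by blast
    qed
  qed
  have rep_orbit: "rep ((g ^^ n) y) = rep y" for n y
    by (induction n) (simp_all add: rep_def E_step)
  obtain T where T: "\<And>c n. (\<And>n. g ((g ^^ n) c) \<noteq> (g ^^ n) c) \<Longrightarrow>
      (\<exists>i\<ge>n. (g ^^ i) c \<in> T c) \<and> (\<exists>i\<ge>n. (g ^^ i) c \<notin> T c)"
    using tails_of_orbit_split[of g] by metis
  define X where "X = {y. y \<in> T (rep y)}"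
  have "(\<exists>i. (g ^^ i) y \<in> X) \<and> (\<exists>i. (g ^^ i) y \<notin> X)"
    if moves: "\<And>n. g ((g ^^ n) y) \<noteq> (g ^^ n) y" for y
  proof -
    obtain m n where mn: "(g ^^ m) y = (g ^^ n) (rep y)"
      using rep[of y] unfolding E_def by blast
    have tail: "(g ^^ (k + m)) y = (g ^^ (k + n)) (rep y)" for k
      by (simp add: funpow_add mn)
    \<comment> \<open>A fixed point on the orbit of \<open>rep y\<close> would stay there forever,
      hence occur in the common tail and so on the orbit of \<open>y\<close>.\<close>
    have "g ((g ^^ k) (rep y)) \<noteq> (g ^^ k) (rep y)" for k
    proof
      assume fixed: "g ((g ^^ k) (rep y)) = (g ^^ k) (rep y)"
      have "(g ^^ (j + k)) (rep y) = (g ^^ k) (rep y)" for j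
        by (induction j) (simp_all add: fixed)
      then have "(g ^^ (k + m)) y = (g ^^ k) (rep y)"
        by (metis tail add.commute)
      then show False using moves[of "k + m"] fixed by simp
    qed
    then obtain i j where "i \<ge> n" "(g ^^ i) (rep y) \<in> T (rep y)"
      and "j \<ge> n" "(g ^^ j) (rep y) \<notin> T (rep y)"
      using T[of "rep y" n] by blast
    \<comment> \<open>By \<open>tail\<close>, index \<open>i\<close> on the orbit of
      \<open>rep y\<close> corresponds to index \<open>i - n + m\<close> on that of
      \<open>y\<close>; this uses \<open>i \<ge> n\<close>.\<close>
    then have "(g ^^ (i - n + m)) y \<in> X" "(g ^^ (j - n + m)) y \<notin> X"
      unfolding X_def mem_Collect_eq rep_orbit unfolding tail by simp_all
    then show ?thesis by blast
  qed
  then show ?thesis by blast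
qed

section \<open>Orderly terms over unary operations\<close>

abbreviation apply_unary :: "'a oper list \<Rightarrow> 'a \<Rightarrow> 'a" where
  "apply_unary fs a \<equiv> fold (\<lambda>f x. app f [x]) fs a"

text \<open>The head of \<open>fs\<close> acts first. The restriction makes the function
  extensional, as \<open>operations\<close> demands.\<close>

definition unary_term :: "'a set \<Rightarrow> 'a oper list \<Rightarrow> 'a oper" where
  "unary_term A fs = (1, \<lambda>xs\<in>nlists 1 A. apply_unary fs (hd xs))"

lemma arity_unary_term [simp]: "arity (unary_term A fs) = 1"
  by (simp add: unary_term_def)

lemma nlists_1: "xs \<in> nlists 1 A \<longleftrightarrow> (\<exists>x\<in>A. xs = [x])"
  unfolding One_nat_def in_nlists_Suc_iff nlists_n_0 by blast

lemma app_unary_term [simp]: "x \<in> A \<Longrightarrow> app (unary_term A fs) [x] = apply_unary fs x"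
  by (simp add: unary_term_def nlists_1)

lemma unary_oper_eqI:
  assumes "f \<in> operations A" "g \<in> operations A" "arity f = 1" "arity g = 1"
    and "\<And>x. x \<in> A \<Longrightarrow> app f [x] = app g [x]"
  shows "f = g"
proof -
  have "app f = app g"
  proof (rule PiE_ext)
    show "app f \<in> nlists 1 A \<rightarrow>\<^sub>E A" "app g \<in> nlists 1 A \<rightarrow>\<^sub>E A"
      using assms by (simp_all add: operations_def)
    show "app f xs = app g xs" if "xs \<in> nlists 1 A" for xs
      using that assms(5) unfolding nlists_1 by blast
  qed
  then show ?thesis using assms by (simp add: prod_eq_iff)
qed

lemma orderly_terms_include: "F \<subseteq> orderly_terms A F"
  and id_oper_in_orderly_terms: "id_oper A \<in> orderly_terms A F"
  unfolding orderly_terms_def by auto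

lemma orderly_composition_mono:
  assumes "C \<subseteq> D" and "orderly_composition A C f"
  shows "orderly_composition A D f"
proof -
  obtain g hs where f: "f \<in> operations A" and "g \<in> C" "set hs \<subseteq> C"
    and eq: "length hs = arity g" "arity f = (\<Sum>h\<leftarrow>hs. arity h)"
      "\<forall>xss. list_all2 (\<lambda>h xs. xs \<in> nlists (arity h) A) hs xss \<longrightarrow>
         app f (concat xss) = app g (map2 app hs xss)"
    using assms(2) unfolding orderly_composition_def by (elim conjE bexE exE) rule
  then have "g \<in> D" "set hs \<subseteq> D" using assms(1) by auto
  show ?thesis
    unfolding orderly_composition_def
    by (intro conjI bexI[of _ g] exI[of _ hs]) fact+
qed

text \<open>By monotonicity, a composition over the intersection is a composition over each closed
  collection, hence belongs to each.\<close>

lemma orderly_terms_closed: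
  assumes "orderly_composition A (orderly_terms A F) f"
  shows "f \<in> orderly_terms A F"
  unfolding orderly_terms_def
proof
  fix C
  assume C: "C \<in> {C. C \<subseteq> operations A \<and> F \<subseteq> C \<and> id_oper A \<in> C \<and>
    (\<forall>f. orderly_composition A C f \<longrightarrow> f \<in> C)}"
  then have "orderly_terms A F \<subseteq> C" unfolding orderly_terms_def by (rule Inter_lower)
  then have "orderly_composition A C f" using assms by (rule orderly_composition_mono)
  with C show "f \<in> C" by blast
qed

lemma inf_concat_singletons: "inf_concat (\<lambda>k. [c k]) = c"
proof
  have "concat (map (\<lambda>k. [c k]) ks) = map c ks" for ks by (induction ks) auto
  then show "inf_concat (\<lambda>k. [c k]) n = c n" for n
    by (simp add: inf_concat_def del: upt_Suc)
qed

lemma apply_unary_fixed: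
  assumes "\<And>f. f \<in> F \<Longrightarrow> app f [s] = s" and "set fs \<subseteq> F"
  shows "apply_unary fs s = s"
  using assms(2) by (induction fs) (auto simp: assms(1))

section \<open>Orderly terms in an algebra of unary operations\<close>

locale unary_algebra =
  fixes A :: "'a set" and F :: "'a oper set"
  assumes algebra: "algebra A F"
    and unary: "f \<in> F \<Longrightarrow> arity f = 1"
begin

lemma app_closed: "f \<in> F \<Longrightarrow> x \<in> A \<Longrightarrow> app f [x] \<in> A"
proof -
  assume f: "f \<in> F" and x: "x \<in> A"
  then have "app f \<in> nlists 1 A \<rightarrow>\<^sub>E A"
    using algebra unary[OF f] unfolding algebra_def operations_def by fastforce
  moreover have "[x] \<in> nlists 1 A" using x unfolding nlists_1 by blast
  ultimately show ?thesis by (rule PiE_mem)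
qed

lemma apply_unary_closed: "set fs \<subseteq> F \<Longrightarrow> x \<in> A \<Longrightarrow> apply_unary fs x \<in> A"
  by (induction fs arbitrary: x) (auto simp: app_closed)

lemma unary_term_operations: "set fs \<subseteq> F \<Longrightarrow> unary_term A fs \<in> operations A"
proof -
  assume "set fs \<subseteq> F"
  then have "apply_unary fs (hd xs) \<in> A" if "xs \<in> nlists 1 A" for xs
    using that apply_unary_closed unfolding nlists_1 by fastforce
  then show ?thesis
    unfolding unary_term_def operations_def mem_Collect_eq fst_conv snd_conv
    by (intro conjI restrict_PiE[THEN iffD2] Pi_I) auto
qed

text \<open>The induction is from the right because the outer operation of an orderly composition is
  the last one applied.\<close>

lemma unary_term_orderly: "set fs \<subseteq> F \<Longrightarrow> unary_term A fs \<in> orderly_terms A F"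
proof (induction fs rule: rev_induct)
  case Nil
  have "unary_term A [] = id_oper A"
    by (simp add: unary_term_def id_oper_def)
  then show ?case by (simp add: id_oper_in_orderly_terms)
next
  case (snoc f fs)
  then have fs: "set fs \<subseteq> F" "f \<in> F" by auto
  have "orderly_composition A (orderly_terms A F) (unary_term A (fs @ [f]))"
    unfolding orderly_composition_def
  proof (intro conjI bexI exI)
    show "unary_term A (fs @ [f]) \<in> operations A"
      using snoc.prems by (rule unary_term_operations)
    show "set [unary_term A fs] \<subseteq> orderly_terms A F" using snoc.IH fs by simp
    show "f \<in> orderly_terms A F" using orderly_terms_include fs by blast
    show "\<forall>xss. list_all2 (\<lambda>h xs. xs \<in> nlists (arity h) A) [unary_term A fs] xss \<longrightarrow>
        app (unary_term A (fs @ [f])) (concat xss) = app f (map2 app [unary_term A fs] xss)"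
      by (auto simp: list_all2_Cons1 nlists_1[unfolded One_nat_def])
  qed (simp_all add: unary fs)
  then show ?case by (rule orderly_terms_closed)
qed

text \<open>By minimality it suffices that the composites satisfy the closure conditions; composing
  two of them concatenates their lists.\<close>

lemma orderly_terms_unary: "orderly_terms A F = unary_term A ` {fs. set fs \<subseteq> F}"
proof
  let ?U = "unary_term A ` {fs. set fs \<subseteq> F}"
  have "?U \<subseteq> operations A" using unary_term_operations by blast
  moreover have "F \<subseteq> ?U"
  proof
    fix f assume f: "f \<in> F"
    then have "f = unary_term A [f]"
      using algebra unary_term_operations[of "[f]"]
      by (intro unary_oper_eqI[of _ A]) (auto simp: algebra_def unary)
    with f show "f \<in> ?U" by auto
  qed
  moreover have "id_oper A \<in> ?U"
    by (rule image_eqI[of _ _ "[]"]) (simp_all add: unary_term_def id_oper_def)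
  moreover have "f \<in> ?U" if "orderly_composition A ?U f" for f
  proof -
    from that obtain g hs where f: "f \<in> operations A" and g: "g \<in> ?U"
      and hs: "set hs \<subseteq> ?U" "length hs = arity g" "arity f = (\<Sum>h\<leftarrow>hs. arity h)"
      and eq: "\<And>xss. list_all2 (\<lambda>h xs. xs \<in> nlists (arity h) A) hs xss \<Longrightarrow>
           app f (concat xss) = app g (map2 app hs xss)"
      unfolding orderly_composition_def by blast
    from g obtain gs where gs: "g = unary_term A gs" "set gs \<subseteq> F" by blast
    \<comment> \<open>As \<open>g\<close> is unary, there is exactly one inner operation.\<close>
    with hs(2) obtain h where h: "hs = [h]" by (auto simp: length_Suc_conv)
    with hs(1) obtain hs' where hs': "h = unary_term A hs'" "set hs' \<subseteq> F" by auto
    have "app f [x] = app (unary_term A (hs' @ gs)) [x]" if "x \<in> A" for x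
      using eq[of "[[x]]"] that
      by (simp add: h hs' gs nlists_1[unfolded One_nat_def] apply_unary_closed)
    then have "f = unary_term A (hs' @ gs)"
      using f hs(3) h hs' gs by (intro unary_oper_eqI[of _ A] unary_term_operations) auto
    then show ?thesis using hs' gs by auto
  qed
  ultimately show "orderly_terms A F \<subseteq> ?U"
    unfolding orderly_terms_def by (intro Inter_lower) blast
  show "?U \<subseteq> orderly_terms A F" using unary_term_orderly by blast
qed

section \<open>Reductions and \<open>FR\<close> in an algebra of unary operations\<close>

lemma reduction_unary:
  assumes a: "range a \<subseteq> A"
  shows "reduction A F b a \<longleftrightarrow>
    (\<exists>r fs. strict_mono r \<and> (\<forall>k. set (fs k) \<subseteq> F \<and> b k = apply_unary (fs k) (a (r k))))"
    (is "_ \<longleftrightarrow> ?R")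
proof
  assume "reduction A F b a"
  then obtain as f where sub: "subsequence_of (inf_concat as) a"
    and f: "\<And>k. f k \<in> orderly_terms A F" "\<And>k. length (as k) = arity (f k)"
    and b: "\<And>k. b k = app (f k) (as k)"
    unfolding reduction_def by blast
  from f(1) have "\<forall>k. \<exists>fs. set fs \<subseteq> F \<and> f k = unary_term A fs"
    unfolding orderly_terms_unary by blast
  then obtain fs where fs: "\<And>k. set (fs k) \<subseteq> F" "\<And>k. f k = unary_term A (fs k)" by metis
  \<comment> \<open>Each \<open>f k\<close> is unary, so \<open>as k\<close> is the singleton of
    \<open>c k\<close>, and the infinite concatenation is \<open>c\<close> itself.\<close>
  define c where "c k = hd (as k)" for k
  have as: "as = (\<lambda>k. [c k])"
  proof
    fix k
    have "length (as k) = 1" by (simp add: f(2) fs(2))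
    then show "as k = [c k]" by (auto simp: c_def length_Suc_conv)
  qed
  from sub obtain r where r: "strict_mono r" "c = a \<circ> r"
    unfolding subsequence_of_def as inf_concat_singletons by blast
  have "b k = apply_unary (fs k) (a (r k))" for k
    using a by (simp add: b fs as r image_subset_iff)
  with r fs show ?R by blast
next
  assume ?R
  then obtain r fs where r: "strict_mono r"
    and fs: "\<And>k. set (fs k) \<subseteq> F" "\<And>k. b k = apply_unary (fs k) (a (r k))" by blast
  show "reduction A F b a"
    unfolding reduction_def
  proof (intro exI conjI allI)
    show "subsequence_of (inf_concat (\<lambda>k. [a (r k)])) a"
      unfolding inf_concat_singletons subsequence_of_def using r by (auto simp: comp_def)
    show "unary_term A (fs k) \<in> orderly_terms A F" for k
      using fs(1) by (rule unary_term_orderly)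
    show "b k = app (unary_term A (fs k)) [a (r k)]" for k
      using a fs(2) by (simp add: image_subset_iff)
  qed simp
qed

lemma FR_unary:
  assumes b: "range b \<subseteq> A"
  shows "FR A F b = {apply_unary fs (b k) | fs k. set fs \<subseteq> F}"
proof -
  have "finite_subsequence_of [x] b \<longleftrightarrow> (\<exists>k. x = b k)" for x
  proof
    show "\<exists>k. x = b k \<Longrightarrow> finite_subsequence_of [x] b"
      unfolding finite_subsequence_of_def by (metis list.map sorted_wrt1)
  qed (auto simp: finite_subsequence_of_def)
  then have "FR A F b = {app (unary_term A fs) [b k] | fs k. set fs \<subseteq> F}"
    unfolding FR_def orderly_terms_unary by (fastforce simp: length_Suc_conv)
  also have "\<dots> = {apply_unary fs (b k) | fs k. set fs \<subseteq> F}"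
    using b by (simp add: image_subset_iff)
  finally show ?thesis .
qed

lemma ramsey_if_reaches_fixed:
  assumes reach: "\<And>a. a \<in> A \<Longrightarrow>
    \<exists>fs. set fs \<subseteq> F \<and> (\<forall>f\<in>F. app f [apply_unary fs a] = apply_unary fs a)"
  shows "ramsey_algebra A F"
  unfolding ramsey_algebra_def
proof (intro conjI allI impI)
  fix a :: "nat \<Rightarrow> 'a" and X
  assume a: "range a \<subseteq> A"
  then have "\<forall>k. \<exists>fs. set fs \<subseteq> F \<and> (\<forall>f\<in>F. app f [apply_unary fs (a k)] = apply_unary fs (a k))"
    by (intro allI reach) auto
  then obtain fs where fs: "\<And>k. set (fs k) \<subseteq> F"
    "\<And>k f. f \<in> F \<Longrightarrow> app f [apply_unary (fs k) (a k)] = apply_unary (fs k) (a k)" by metis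
  define s where "s k = apply_unary (fs k) (a k)" for k
  \<comment> \<open>Pigeonhole on the fixed points \<open>s k\<close>: the two index sets cover the
    natural numbers.\<close>
  have "infinite {k. s k \<in> X} \<or> infinite {k. s k \<notin> X}"
    using finite_UnI[of "{k. s k \<in> X}" "{k. s k \<notin> X}"] by (auto simp: Un_def)
  then obtain N where N: "infinite N" "N \<subseteq> {k. s k \<in> X} \<or> N \<subseteq> {k. s k \<notin> X}" by blast
  then obtain r :: "nat \<Rightarrow> nat" where r: "strict_mono r" "\<And>k. r k \<in> N"
    using infinite_enumerate by blast
  let ?b = "s \<circ> r"
  have "reduction A F ?b a"
    unfolding reduction_unary[OF a]
    using r(1) fs(1) by (intro exI[of _ r] exI[of _ "fs \<circ> r"]) (simp add: s_def)
  moreover have "range ?b \<subseteq> A"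
    using a fs(1) by (auto simp: s_def intro!: apply_unary_closed)
  \<comment> \<open>Every term fixes the entries of \<open>?b\<close>, so \<open>FR\<close> adds
    nothing to its range.\<close>
  moreover have "apply_unary gs (?b k) = ?b k" if "set gs \<subseteq> F" for gs k
    using that fs(2) by (intro apply_unary_fixed) (simp_all add: s_def)
  ultimately have red: "reduction A F ?b a" and "FR A F ?b \<subseteq> range ?b"
    unfolding FR_unary[OF \<open>range ?b \<subseteq> A\<close>] by auto
  then have "FR A F ?b \<subseteq> X \<or> FR A F ?b \<inter> X = {}"
    using N(2) r(2) by fastforce
  with red show "\<exists>b. reduction A F b a \<and> (FR A F b \<subseteq> X \<or> FR A F b \<inter> X = {})"
    by blast
qed (rule algebra)

text \<open>If \<open>x\<close> reaches no common fixed point, a function \<open>g\<close> moves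
  every point reachable from \<open>x\<close>. For each reduction \<open>b\<close> of the constant
  sequence \<open>x\<close>, the \<open>g\<close>-orbit of \<open>b 0\<close> lies in
  \<open>FR A F b\<close> and is split by \<open>X\<close>.\<close>

lemma reaches_fixed_if_ramsey:
  assumes ramsey: "ramsey_algebra A F" and x: "x \<in> A"
  shows "\<exists>fs. set fs \<subseteq> F \<and> (\<forall>f\<in>F. app f [apply_unary fs x] = apply_unary fs x)"
proof (rule ccontr)
  assume none: "\<not> ?thesis"
  define R where "R y = {apply_unary fs y | fs. set fs \<subseteq> F}" for y
  have "\<forall>y\<in>R x. \<exists>f\<in>F. app f [y] \<noteq> y"
    using none unfolding R_def by blast
  then obtain f where f: "\<And>y. y \<in> R x \<Longrightarrow> f y \<in> F \<and> app (f y) [y] \<noteq> y"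
    by metis
  \<comment> \<open>Outside \<open>R x\<close> the choice \<open>f\<close> is unconstrained;
    \<open>orbit\<close> shows that iterates of \<open>g\<close> starting in \<open>R x\<close>
    never leave it.\<close>
  define g where "g y = app (f y) [y]" for y
  have R_step: "app h [z] \<in> R y" if "z \<in> R y" "h \<in> F" for h y z
  proof -
    obtain fs where "set fs \<subseteq> F" "z = apply_unary fs y" using \<open>z \<in> R y\<close> R_def by blast
    then show ?thesis using \<open>h \<in> F\<close> unfolding R_def by (auto intro!: exI[of _ "fs @ [h]"])
  qed
  have R_self: "y \<in> R y" for y
    unfolding R_def by (auto intro!: exI[of _ "[]"])
  have orbit: "(g ^^ n) y \<in> R x \<and> (g ^^ n) y \<in> R y" if "y \<in> R x" for n y
    by (induction n) (use that R_self f R_step in \<open>auto simp: g_def\<close>)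
  obtain X where X: "\<And>y. (\<And>n. g ((g ^^ n) y) \<noteq> (g ^^ n) y) \<Longrightarrow>
    (\<exists>i. (g ^^ i) y \<in> X) \<and> (\<exists>i. (g ^^ i) y \<notin> X)"
    using orbits_split[of g] by blast
  have a: "range (\<lambda>_::nat. x) \<subseteq> A" using x by auto
  \<comment> \<open>The splitting set may exceed \<open>A\<close>, so homogeneity is taken for
    \<open>X \<inter> A\<close>; the orbit lies in \<open>A\<close>, where the two sets
    agree.\<close>
  with ramsey obtain b where b: "reduction A F b (\<lambda>_. x)"
    and hom: "FR A F b \<subseteq> X \<inter> A \<or> FR A F b \<inter> (X \<inter> A) = {}"
    unfolding ramsey_algebra_def by (meson inf_le2)
  from b have bR: "b k \<in> R x" for k
    unfolding reduction_unary[OF a] R_def by blast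
  have RA: "R x \<subseteq> A"
    using x unfolding R_def by (auto intro: apply_unary_closed)
  with bR have bA: "range b \<subseteq> A" by blast
  have FR: "(g ^^ n) (b 0) \<in> FR A F b \<and> (g ^^ n) (b 0) \<in> A" for n
    using orbit[OF bR, of n 0] RA unfolding FR_unary[OF bA] R_def by blast
  have "g ((g ^^ n) (b 0)) \<noteq> (g ^^ n) (b 0)" for n
    using f orbit[OF bR, of n 0] unfolding g_def by blast
  then show False using X[of "b 0"] FR hom by blast
qed

end

theorem theorem4p4:
  fixes A S :: "'a set" and F :: "'a oper set"
  assumes "algebra A F"
    and "\<forall>f\<in>F. arity f = 1"
    and "S = {a \<in> A. \<forall>f\<in>F. app f [a] = a}"
  shows "ramsey_algebra A F \<longleftrightarrow>
    (\<forall>a\<in>A. \<exists>fs. set fs \<subseteq> F \<and> fold (\<lambda>f x. app f [x]) fs a \<in> S)"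
proof -
  interpret unary_algebra A F
    using assms(1,2) by unfold_locales auto
  \<comment> \<open>The membership in \<open>A\<close> that \<open>S\<close> requires comes from
    closure under the operations.\<close>
  have "apply_unary fs a \<in> S \<longleftrightarrow> (\<forall>f\<in>F. app f [apply_unary fs a] = apply_unary fs a)"
    if "set fs \<subseteq> F" "a \<in> A" for fs a
    using apply_unary_closed[OF that] assms(3) by simp
  then show ?thesis
    using ramsey_if_reaches_fixed reaches_fixed_if_ramsey by meson
qed

end
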